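(* Let $n\ge 1$, $I=\{1,\ldots,n\}$, let $V=(v_{ij})\in\mathbb{R}_{\ge 0}^{n\times n}$ be a valuation matrix, let $X=(x_{ij})\in\{0,1\}^{n\times n}$ be the permutation matrix of a maximum weight perfect matching for $V$, and put $V'=X^TV=(v'_{ij})$ and $u_{ij}=v'_{ij}-v'_{jj}$ for $i,j\in I$. Let $y_j=\lim_{t\to\infty}y_j^{(t)}$ for $j\in I$, where $y_j^{(0)}=0$ and $y_j^{(t+1)}=\max_{k\in I}\{y_k^{(t)}+u_{jk}\}$ (these limits exist). Let $\mathbf{p}=(p_1,\ldots,p_n)$ be such that $$p_j=v'_{jj}-y_j,\quad \forall j\in I.$$ Then $\mathbf{p}$ is an envy-free price vector that maximizes the seller's revenue in the envy-free perfect matching problem with valuation matrix $V$.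
   Context: Envy-free perfect matching problem: there are $n$ consumers and $n$ distinct items, both indexed by $\{1,\ldots,n\}$, each item with a single unit available, and each consumer buys exactly one item, so an allocation is a bijection (perfect matching) $\sigma$ from consumers to items. Consumer $i$ values item $j$ at $v_{ij}\ge 0$. A price vector is $\mathbf{p}=(p_1,\ldots,p_n)\in\mathbb{R}_{\ge 0}^n$; the utility of consumer $i$ for item $j$ is $v_{ij}-p_j$, and buying nothing gives utility $0$. The demand set of consumer $i$ consists of the options (single items or nothing) of maximum utility for $i$; in particular every item in it has nonnegative utility. An allocation is envy-free for $\mathbf{p}$ if every consumer receives an item from their demand set, i.e. $v_{i\sigma(i)}-p_{\sigma(i)}\ge v_{ij}-p_j$ for all items $j$ and $v_{i\sigma(i)}-p_{\sigma(i)}\ge 0$. A price vector is envy-free if it is nonnegative and admits an envy-free allocation. The seller's revenue is the sum of the prices of the items sold, i.e. $\sum_{j=1}^n p_j$; the problem is to maximize it over all envy-free price vectors and corresponding envy-free allocations. Maximum weight perfect matching: a permutation matrix $X$ ($x_{ij}=1$ meaning consumer $i$ is assigned item $j$) maximizing $\mathrm{tr}(X^TV)=\sum_{i,j}x_{ij}v_{ij}$ over all $n\times n$ permutation matrices. Thus row $j$ of $V'=X^TV$ is the valuation row of the consumer to whom item $j$ is assigned. *)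

theory Defs
  imports "HOL-Analysis.Analysis"
begin

text \<open>
  Consumers and items are both indexed by the same finite type \<open>'n\<close>, so that
  \<open>n = CARD('n) \<ge> 1\<close>; \<open>V $ i $ j\<close> is the value of item \<open>j\<close> to consumer \<open>i\<close>.
  An option is \<open>Some j\<close> (buying item \<open>j\<close>) or \<open>None\<close> (buying nothing).
\<close>

fun utility :: "real ^ 'n ^ 'n \<Rightarrow> real ^ 'n \<Rightarrow> 'n \<Rightarrow> 'n option \<Rightarrow> real" where
  "utility V p i None = 0"
| "utility V p i (Some j) = V $ i $ j - p $ j"

definition demand_set :: "real ^ 'n ^ 'n \<Rightarrow> real ^ 'n \<Rightarrow> 'n \<Rightarrow> 'n option set" where
  "demand_set V p i = {a. \<forall>b. utility V p i b \<le> utility V p i a}"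

definition envy_free_allocation :: "real ^ 'n ^ 'n \<Rightarrow> real ^ 'n \<Rightarrow> ('n \<Rightarrow> 'n) \<Rightarrow> bool" where
  "envy_free_allocation V p \<sigma> \<longleftrightarrow> bij \<sigma> \<and> (\<forall>i. Some (\<sigma> i) \<in> demand_set V p i)"

definition envy_free_price_vector :: "real ^ 'n ^ 'n \<Rightarrow> real ^ 'n \<Rightarrow> bool" where
  "envy_free_price_vector V p \<longleftrightarrow> (\<forall>j. 0 \<le> p $ j) \<and> (\<exists>\<sigma>. envy_free_allocation V p \<sigma>)"

definition revenue :: "real ^ 'n \<Rightarrow> ('n::finite \<Rightarrow> 'n) \<Rightarrow> real" where
  "revenue p \<sigma> = (\<Sum>i\<in>UNIV. p $ \<sigma> i)"

text \<open>
  All envy-free allocations are bijections, so every item is sold and the revenue is the same for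
  each of them; optimality is therefore required of all envy-free allocations for \<open>p\<close>.
\<close>

definition maximizes_revenue :: "real ^ 'n ^ 'n \<Rightarrow> real ^ 'n \<Rightarrow> bool" where
  "maximizes_revenue V p \<longleftrightarrow> envy_free_price_vector V p \<and>
     (\<forall>\<sigma> q \<tau>. envy_free_allocation V p \<sigma> \<longrightarrow>
        envy_free_price_vector V q \<longrightarrow> envy_free_allocation V q \<tau> \<longrightarrow>
        revenue q \<tau> \<le> revenue p \<sigma>)"

definition permutation_matrix :: "real ^ 'n ^ 'n \<Rightarrow> bool" where
  "permutation_matrix X \<longleftrightarrow>
     (\<forall>i j. X $ i $ j \<in> {0, 1}) \<and>
     (\<forall>i. \<exists>!j. X $ i $ j = 1) \<and>
     (\<forall>j. \<exists>!i. X $ i $ j = 1)"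

definition max_weight_perfect_matching :: "real ^ 'n ^ 'n \<Rightarrow> real ^ 'n ^ 'n \<Rightarrow> bool" where
  "max_weight_perfect_matching V X \<longleftrightarrow> permutation_matrix X \<and>
     (\<forall>Z. permutation_matrix Z \<longrightarrow> trace (transpose Z ** V) \<le> trace (transpose X ** V))"

fun max_plus_iterate :: "real ^ 'n ^ 'n \<Rightarrow> nat \<Rightarrow> 'n::finite \<Rightarrow> real" where
  "max_plus_iterate U 0 j = 0"
| "max_plus_iterate U (Suc t) j = (MAX k. max_plus_iterate U t k + U $ j $ k)"

end

theory Submission
  imports Defs "HOL-Combinatorics.Cycles"
begin

text \<open>
  After relabelling consumers by the items they receive, optimality of the matching says that
  \<open>U\<close> has zero diagonal and no cycle of positive weight.  The iterate at \<open>j\<close> is the weight of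
  a walk starting at \<open>j\<close>; closing the walk up to a cycle bounds it by \<open>V'\<^sub>j\<^sub>j\<close>, so
  the increasing iterates converge to a fixed point \<open>y\<close> with \<open>0 \<le> y\<^sub>j \<le> V'\<^sub>j\<^sub>j\<close>.  The fixed
  point property is exactly envy-freeness of the prices \<open>V'\<^sub>j\<^sub>j - y\<^sub>j\<close>.  Conversely, every
  envy-free price vector \<open>q\<close> supports every maximum weight matching, so the
  utilities \<open>V'\<^sub>j\<^sub>j - q\<^sub>j\<close> form a nonnegative supersolution of the recursion and dominate \<open>y\<close>.
  Hence \<open>q \<le> p\<close> in every coordinate.
\<close>

section \<open>Walks without positive cycles\<close>

fun walk_weight :: "('a \<Rightarrow> 'a \<Rightarrow> real) \<Rightarrow> 'a list \<Rightarrow> real" where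
  "walk_weight w (x # y # xs) = w x y + walk_weight w (y # xs)"
| "walk_weight w xs = 0"

lemma walk_weight_append:
  "walk_weight w (xs @ a # ys) = walk_weight w (xs @ [a]) + walk_weight w (a # ys)"
proof (induction xs)
  case (Cons x xs)
  then show ?case by (cases xs) auto
qed simp

lemma walk_weight_snoc:
  "walk_weight w (x # xs @ [z]) = sum_list (map2 w (x # xs) (xs @ [z]))"
  by (induction xs arbitrary: x) auto

text \<open>A simple cycle extends by the identity to a permutation of the whole type. The added
  fixed points contribute nothing because of \<open>diag\<close>, so the cycle weight is the full
  sum bounded by \<open>perm\<close>.\<close>

lemma cycle_weight_nonpos:
  fixes w :: "'a::finite \<Rightarrow> 'a \<Rightarrow> real"
  assumes diag: "\<And>x. w x x = 0"
    and perm: "\<And>\<pi>. bij \<pi> \<Longrightarrow> (\<Sum>x\<in>UNIV. w x (\<pi> x)) \<le> 0"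
    and "distinct (x # xs)"
  shows "walk_weight w (x # xs @ [x]) \<le> 0"
proof -
  define \<pi> where "\<pi> = cycle_of_list (x # xs)"
  have \<pi>: "\<pi> permutes set (x # xs)"
    unfolding \<pi>_def by (rule cycle_permutes)
  have rot: "map \<pi> (x # xs) = xs @ [x]"
    using cyclic_rotation[of "x # xs" 1] assms(3) by (simp add: \<pi>_def)
  have "walk_weight w (x # xs @ [x]) = sum_list (map2 w (x # xs) (map \<pi> (x # xs)))"
    by (simp only: walk_weight_snoc rot)
  also have "\<dots> = sum_list (map (\<lambda>z. w z (\<pi> z)) (x # xs))"
    by (simp add: zip_map2 zip_same_conv_map comp_def)
  also have "\<dots> = (\<Sum>z\<in>set (x # xs). w z (\<pi> z))"
    using assms(3) by (rule sum_list_distinct_conv_sum_set)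
  also have "\<dots> = (\<Sum>z\<in>UNIV. w z (\<pi> z))"
    using \<pi> by (intro sum.mono_neutral_left) (auto simp: permutes_def diag)
  also have "\<dots> \<le> 0"
    using \<pi> by (intro perm) (rule permutes_bij)
  finally show ?thesis .
qed

text \<open>Strong induction on length: a repeated vertex \<open>a\<close> splits the walk into two
  shorter closed walks whose weights add up. Without a repetition the walk is a simple
  cycle.\<close>

lemma closed_walk_weight_nonpos:
  fixes w :: "'a::finite \<Rightarrow> 'a \<Rightarrow> real"
  assumes diag: "\<And>x. w x x = 0"
    and perm: "\<And>\<pi>. bij \<pi> \<Longrightarrow> (\<Sum>x\<in>UNIV. w x (\<pi> x)) \<le> 0"
  shows "walk_weight w (x # xs @ [x]) \<le> 0"
proof (induction "length xs" arbitrary: x xs rule: less_induct)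
  case less
  show ?case
  proof (cases "distinct (x # xs)")
    case True
    show ?thesis by (rule cycle_weight_nonpos; fact)
  next
    case False
    then obtain as bs cs a where dec: "x # xs = as @ [a] @ bs @ [a] @ cs"
      using not_distinct_decomp by blast
    have len: "length xs = length as + length bs + length cs + 1"
      using arg_cong[OF dec, of length] by simp
    have "walk_weight w (x # xs @ [x]) = walk_weight w (as @ a # bs @ a # cs @ [x])"
      using dec by (metis append.assoc append_Cons append_Nil)
    also have "\<dots> = walk_weight w (a # bs @ [a])
        + (walk_weight w (as @ [a]) + walk_weight w (a # cs @ [x]))"
      using walk_weight_append[of w as a "bs @ a # cs @ [x]"]
        walk_weight_append[of w "a # bs" a "cs @ [x]"] by simp
    also have "\<dots> = walk_weight w (a # bs @ [a]) + walk_weight w (as @ a # cs @ [x])"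
      using walk_weight_append[of w as a "cs @ [x]"] by simp
    \<comment> \<open>What remains after the loop at \<open>a\<close> is cut out is closed at
      \<open>x\<close>; if \<open>as\<close> is empty, this is because \<open>a\<close> is the
      starting vertex itself.\<close>
    also have "walk_weight w (as @ a # cs @ [x]) \<le> 0"
    proof (cases as)
      case Nil
      then have "a = x" using dec by simp
      then show ?thesis using less[of cs x] Nil len by simp
    next
      case (Cons b bs')
      then have "b = x" using dec by simp
      then show ?thesis using less[of "bs' @ a # cs" x] Cons len by simp
    qed
    also have "walk_weight w (a # bs @ [a]) \<le> 0"
      using less[of bs a] len by simp
    finally show ?thesis by simp
  qed
qed

section \<open>The max-plus iteration\<close>

lemma max_plus_iterate_ge:
  "max_plus_iterate U t k + U $ j $ k \<le> max_plus_iterate U (Suc t) j"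
  by (auto intro: Max_ge)

lemma max_plus_iterate_attained:
  obtains k where "max_plus_iterate U (Suc t) j = max_plus_iterate U t k + U $ j $ k"
proof -
  have "(MAX k. max_plus_iterate U t k + U $ j $ k) \<in> range (\<lambda>k. max_plus_iterate U t k + U $ j $ k)"
    by (intro Max_in) auto
  then show ?thesis unfolding max_plus_iterate.simps by (rule rangeE) (rule that, simp)
qed

lemma max_plus_iterate_walk:
  "\<exists>xs. max_plus_iterate U t j = walk_weight (\<lambda>i k. U $ i $ k) (j # xs)"
proof (induction t arbitrary: j)
  case 0
  then show ?case by (intro exI[of _ "[]"]) simp
next
  case (Suc t)
  obtain k where k: "max_plus_iterate U (Suc t) j = max_plus_iterate U t k + U $ j $ k"
    by (rule max_plus_iterate_attained)
  obtain xs where "max_plus_iterate U t k = walk_weight (\<lambda>i k. U $ i $ k) (k # xs)"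
    using Suc by blast
  with k show ?case by (intro exI[of _ "k # xs"]) simp
qed

text \<open>Here \<open>k\<close> is the end of a walk from \<open>j\<close> that realizes the
  iterate; one more step back to \<open>j\<close> closes it. This yields an upper bound on the
  iterate that does not depend on \<open>t\<close>.\<close>

lemma max_plus_iterate_closing:
  assumes "\<And>j. U $ j $ j = 0"
    and "\<And>\<pi>. bij \<pi> \<Longrightarrow> (\<Sum>j\<in>UNIV. U $ j $ \<pi> j) \<le> 0"
  obtains k where "max_plus_iterate U t j + U $ k $ j \<le> 0"
proof -
  let ?w = "\<lambda>i k. U $ i $ k"
  obtain xs where xs: "max_plus_iterate U t j = walk_weight ?w (j # xs)"
    using max_plus_iterate_walk by blast
  define ys k where "ys = butlast (j # xs)" and "k = last (j # xs)"
  have ys: "j # xs = ys @ [k]"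
    by (simp add: ys_def k_def)
  have closed: "j # xs @ [j] = ys @ [k, j]"
    using arg_cong[OF ys, of "\<lambda>zs. zs @ [j]"] by simp
  have "walk_weight ?w (j # xs) + U $ k $ j = walk_weight ?w (j # xs @ [j])"
    using walk_weight_append[of ?w ys k "[j]"] by (simp add: ys closed)
  also have "\<dots> \<le> 0"
    using assms by (intro closed_walk_weight_nonpos)
  finally show ?thesis using that xs by simp
qed

lemma max_plus_iterate_mono:
  assumes "\<And>j. U $ j $ j = 0"
  shows "incseq (\<lambda>t. max_plus_iterate U t j)"
proof (rule incseq_SucI)
  fix t
  show "max_plus_iterate U t j \<le> max_plus_iterate U (Suc t) j"
    using max_plus_iterate_ge[of U t j j] assms by simp
qed

text \<open>The recursion is monotone and starts at 0, so it never overtakes a nonnegative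
  supersolution. This is the source of the optimality of the prices.\<close>

lemma max_plus_iterate_le_supersolution:
  assumes "\<And>j. 0 \<le> z j" and "\<And>j k. z k + U $ j $ k \<le> z j"
  shows "max_plus_iterate U t j \<le> z j"
proof (induction t arbitrary: j)
  case 0
  then show ?case using assms by simp
next
  case (Suc t)
  obtain k where "max_plus_iterate U (Suc t) j = max_plus_iterate U t k + U $ j $ k"
    by (rule max_plus_iterate_attained)
  with Suc[of k] assms(2)[of k j] show ?case by simp
qed

section \<open>Matchings and envy-free prices\<close>

lemma permutation_matrixE:
  assumes "permutation_matrix X"
  obtains \<sigma> where "bij \<sigma>" "\<And>i j. X $ i $ j = (if j = \<sigma> i then 1 else 0)"
proof -
  have ex1: "\<exists>!j. X $ i $ j = 1" "\<exists>!i. X $ i $ j = 1" and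
    val: "X $ i $ j = 0 \<or> X $ i $ j = 1" for i j
    using assms unfolding permutation_matrix_def by blast+
  define \<sigma> where "\<sigma> i = (THE j. X $ i $ j = 1)" for i
  have \<sigma>: "X $ i $ j = 1 \<longleftrightarrow> j = \<sigma> i" for i j
    unfolding \<sigma>_def using theI'[OF ex1(1)[of i]] ex1(1)[of i] by blast
  have "bij \<sigma>"
    unfolding bij_def inj_def surj_def using ex1(2) \<sigma> by metis
  moreover have "X $ i $ j = (if j = \<sigma> i then 1 else 0)" for i j
    using val[of i j] \<sigma>[of i j] by auto
  ultimately show ?thesis by (rule that)
qed

lemma permutation_matrix_bij:
  assumes "bij \<sigma>"
  shows "permutation_matrix (\<chi> i j. if j = \<sigma> i then 1 else 0)"
  using assms unfolding permutation_matrix_def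
  by (auto simp: bij_def inj_def surj_def)

lemma transpose_permutation_mult:
  fixes V X :: "real ^ 'n ^ 'n"
  assumes "bij \<sigma>" "\<And>i j. X $ i $ j = (if j = \<sigma> i then 1 else 0)"
  shows "(transpose X ** V) $ \<sigma> i $ k = V $ i $ k"
  using assms unfolding matrix_matrix_mult_def transpose_def
  by (simp add: bij_def inj_eq if_distrib[of "\<lambda>c. c * _"] cong: if_cong)

lemma trace_permutation_mult:
  fixes V X :: "real ^ 'n ^ 'n"
  assumes "bij \<sigma>" "\<And>i j. X $ i $ j = (if j = \<sigma> i then 1 else 0)"
  shows "trace (transpose X ** V) = (\<Sum>i\<in>UNIV. V $ i $ \<sigma> i)"
proof -
  have "trace (transpose X ** V) = (\<Sum>i\<in>UNIV. (transpose X ** V) $ \<sigma> i $ \<sigma> i)"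
    unfolding trace_def by (rule sum.reindex_bij_betw[OF assms(1), symmetric])
  then show ?thesis by (simp add: transpose_permutation_mult[OF assms])
qed

lemma max_weight_perfect_matchingE:
  fixes V X :: "real ^ 'n ^ 'n"
  assumes "max_weight_perfect_matching V X"
  obtains \<sigma> where "bij \<sigma>" "\<And>i k. (transpose X ** V) $ \<sigma> i $ k = V $ i $ k"
    "\<And>\<tau>. bij \<tau> \<Longrightarrow> (\<Sum>i\<in>UNIV. V $ i $ \<tau> i) \<le> (\<Sum>i\<in>UNIV. V $ i $ \<sigma> i)"
proof -
  obtain \<sigma> where \<sigma>: "bij \<sigma>" "\<And>i j. X $ i $ j = (if j = \<sigma> i then 1 else 0)"
    using assms permutation_matrixE unfolding max_weight_perfect_matching_def by blast
  have "(\<Sum>i\<in>UNIV. V $ i $ \<tau> i) \<le> (\<Sum>i\<in>UNIV. V $ i $ \<sigma> i)" if "bij \<tau>" for \<tau>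
  proof -
    let ?Z = "(\<chi> i j. if j = \<tau> i then 1 else 0) :: real ^ 'n ^ 'n"
    have "trace (transpose ?Z ** V) \<le> trace (transpose X ** V)"
      using assms permutation_matrix_bij[OF that] unfolding max_weight_perfect_matching_def by blast
    then show ?thesis
      using trace_permutation_mult[OF \<sigma>] trace_permutation_mult[OF that, of ?Z] by simp
  qed
  with \<sigma> show ?thesis
    using that transpose_permutation_mult[OF \<sigma>] by blast
qed

lemma envy_free_allocation_iff:
  "envy_free_allocation V p \<sigma> \<longleftrightarrow> bij \<sigma> \<and>
     (\<forall>i. 0 \<le> V $ i $ \<sigma> i - p $ \<sigma> i \<and> (\<forall>j. V $ i $ j - p $ j \<le> V $ i $ \<sigma> i - p $ \<sigma> i))"
  unfolding envy_free_allocation_def demand_set_def by (simp add: split_option_all)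

lemma revenue_bij: "bij \<sigma> \<Longrightarrow> revenue p \<sigma> = (\<Sum>j\<in>UNIV. p $ j)"
  unfolding revenue_def by (rule sum.reindex_bij_betw)

text \<open>
  Both matchings pay the same total price, so the pointwise utility comparison between
  \<open>\<tau>\<close> and \<open>\<sigma>\<close> is tight when summed.
\<close>

lemma envy_free_max_weight_matching:
  fixes V :: "real ^ 'n ^ 'n"
  assumes ef: "envy_free_allocation V q \<tau>" and "bij \<sigma>"
    and max: "(\<Sum>i\<in>UNIV. V $ i $ \<tau> i) \<le> (\<Sum>i\<in>UNIV. V $ i $ \<sigma> i)"
  shows "envy_free_allocation V q \<sigma>"
proof -
  have \<tau>: "bij \<tau>" "0 \<le> V $ i $ \<tau> i - q $ \<tau> i" "V $ i $ j - q $ j \<le> V $ i $ \<tau> i - q $ \<tau> i" for i j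
    using ef unfolding envy_free_allocation_iff by auto
  let ?gap = "\<lambda>i. (V $ i $ \<tau> i - q $ \<tau> i) - (V $ i $ \<sigma> i - q $ \<sigma> i)"
  have "(\<Sum>i\<in>UNIV. q $ \<tau> i) = (\<Sum>i\<in>UNIV. q $ \<sigma> i)"
    using revenue_bij[OF \<tau>(1), of q] revenue_bij[OF \<open>bij \<sigma>\<close>, of q] by (simp add: revenue_def)
  then have "(\<Sum>i\<in>UNIV. ?gap i) \<le> 0"
    using max by (simp add: sum_subtractf)
  moreover have nonneg: "0 \<le> ?gap i" for i using \<tau>(3)[of i "\<sigma> i"] by simp
  then have "0 \<le> (\<Sum>i\<in>UNIV. ?gap i)" by (intro sum_nonneg)
  ultimately have "(\<Sum>i\<in>UNIV. ?gap i) = 0" by (rule antisym)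
  then have "\<forall>i\<in>UNIV. ?gap i = 0"
    by (subst (asm) sum_nonneg_eq_0_iff) (simp_all only: finite nonneg)
  then have eq: "V $ i $ \<sigma> i - q $ \<sigma> i = V $ i $ \<tau> i - q $ \<tau> i" for i
    by simp
  show ?thesis
    unfolding envy_free_allocation_iff eq by (intro conjI allI \<open>bij \<sigma>\<close> \<tau>(2,3))
qed

theorem theorem2p8:
  fixes V X V' U :: "real ^ 'n ^ 'n"
    and y p :: "real ^ 'n"
  assumes "\<And>i j. 0 \<le> V $ i $ j"
    and "max_weight_perfect_matching V X"
    and "V' = transpose X ** V"
    and "\<And>i j. U $ i $ j = V' $ i $ j - V' $ j $ j"
    and "\<And>j. y $ j = lim (\<lambda>t. max_plus_iterate U t j)"
    and "\<And>j. p $ j = V' $ j $ j - y $ j"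
  shows "(\<forall>j. convergent (\<lambda>t. max_plus_iterate U t j)) \<and>
         envy_free_price_vector V p \<and> maximizes_revenue V p"
proof -
  let ?m = "max_plus_iterate U"
  obtain \<sigma> where \<sigma>: "bij \<sigma>" and V': "\<And>i k. V' $ \<sigma> i $ k = V $ i $ k"
    and max: "\<And>\<tau>. bij \<tau> \<Longrightarrow> (\<Sum>i\<in>UNIV. V $ i $ \<tau> i) \<le> (\<Sum>i\<in>UNIV. V $ i $ \<sigma> i)"
    using max_weight_perfect_matchingE[OF assms(2), folded assms(3)] by blast
  have item: "\<exists>i. j = \<sigma> i" for j using bij_is_surj[OF \<sigma>] by (rule surjD)
  have diag: "U $ j $ j = 0" for j by (simp add: assms(4))
  \<comment> \<open>The sum is the weight of the matching \<open>\<pi> \<circ> \<sigma>\<close>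
    minus that of \<open>\<sigma>\<close>: reindexing along \<open>\<pi>\<close> turns the
    subtracted terms into the trace of \<open>V'\<close>.\<close>
  have perm: "(\<Sum>j\<in>UNIV. U $ j $ \<pi> j) \<le> 0" if "bij \<pi>" for \<pi>
  proof -
    have "(\<Sum>j\<in>UNIV. U $ j $ \<pi> j) = (\<Sum>j\<in>UNIV. V' $ j $ \<pi> j) - (\<Sum>j\<in>UNIV. V' $ \<pi> j $ \<pi> j)"
      by (simp add: assms(4) sum_subtractf)
    also have "(\<Sum>j\<in>UNIV. V' $ \<pi> j $ \<pi> j) = (\<Sum>j\<in>UNIV. V' $ j $ j)"
      using that by (rule sum.reindex_bij_betw)
    also have "\<dots> = (\<Sum>i\<in>UNIV. V' $ \<sigma> i $ \<sigma> i)"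
      using sum.reindex_bij_betw[OF \<sigma>, of "\<lambda>j. V' $ j $ j"] by simp
    also have "(\<Sum>j\<in>UNIV. V' $ j $ \<pi> j) = (\<Sum>i\<in>UNIV. V' $ \<sigma> i $ \<pi> (\<sigma> i))"
      using sum.reindex_bij_betw[OF \<sigma>, of "\<lambda>j. V' $ j $ \<pi> j"] by simp
    finally show ?thesis
      using max[OF bij_comp[OF \<sigma> that]] by (simp add: V')
  qed
  \<comment> \<open>Closing the walk gives the bound \<open>V' $ j $ j - V' $ k $ j\<close>, and
    valuations are nonnegative.\<close>
  have bound: "?m t j \<le> V' $ j $ j" for t j
  proof -
    obtain k where "?m t j + U $ k $ j \<le> 0"
      using max_plus_iterate_closing[OF diag perm] by blast
    moreover have "0 \<le> V' $ k $ j" using item[of k] assms(1) V' by auto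
    ultimately show ?thesis by (simp add: assms(4))
  qed
  have inc: "incseq (\<lambda>t. ?m t j)" for j
    using diag by (rule max_plus_iterate_mono)
  have conv: "convergent (\<lambda>t. ?m t j)" for j
    using incseq_convergent[OF inc[of j]] bound by (metis convergent_def)
  have lim: "(\<lambda>t. ?m t j) \<longlonglongrightarrow> y $ j" for j
    using conv[of j] by (simp add: assms(5) convergent_LIMSEQ_iff)
  have y_nonneg: "0 \<le> y $ j" for j
    using incseq_le[OF inc lim, of 0 j] by simp
  have y_le: "y $ j \<le> V' $ j $ j" for j
    using LIMSEQ_le_const2[OF lim[of j]] bound[of _ j] by blast
  have y_super: "y $ k + U $ j $ k \<le> y $ j" for j k
  proof (rule LIMSEQ_le)
    show "(\<lambda>t. ?m t k + U $ j $ k) \<longlonglongrightarrow> y $ k + U $ j $ k"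
      by (intro tendsto_intros lim)
    show "(\<lambda>t. ?m (Suc t) j) \<longlonglongrightarrow> y $ j"
      using lim by (rule LIMSEQ_Suc)
  qed (use max_plus_iterate_ge in blast)
  \<comment> \<open>At prices \<open>p\<close>, consumer \<open>i\<close> gets utility
    \<open>y $ \<sigma> i\<close> from the item \<open>\<sigma> i\<close>.\<close>
  have "V $ i $ j - p $ j \<le> V $ i $ \<sigma> i - p $ \<sigma> i" for i j
    using y_super[of j "\<sigma> i"] V'[of i] by (simp add: assms(4,6))
  moreover have "0 \<le> V $ i $ \<sigma> i - p $ \<sigma> i" for i
    using y_nonneg[of "\<sigma> i"] V'[of i] by (simp add: assms(6))
  ultimately have "envy_free_allocation V p \<sigma>"
    using \<sigma> unfolding envy_free_allocation_iff by blast
  then have ef: "envy_free_price_vector V p"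
    using y_le unfolding envy_free_price_vector_def by (auto simp: assms(6))
  have dominates: "q $ j \<le> p $ j" if "envy_free_allocation V q \<tau>" for q \<tau> j
  proof -
    have "bij \<tau>" using that by (simp add: envy_free_allocation_def)
    then have "envy_free_allocation V q \<sigma>"
      using envy_free_max_weight_matching[OF that \<sigma>] max by blast
    then have q: "0 \<le> V $ i $ \<sigma> i - q $ \<sigma> i" "V $ i $ k - q $ k \<le> V $ i $ \<sigma> i - q $ \<sigma> i" for i k
      unfolding envy_free_allocation_iff by auto
    \<comment> \<open>The utility at prices \<open>q\<close> of the consumer to whom
      \<open>\<sigma>\<close> assigns item \<open>j\<close>. Individual rationality makes
      \<open>z\<close> nonnegative, and absence of envy makes it a supersolution.\<close>
    define z where "z j = V' $ j $ j - q $ j" for j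
    have "0 \<le> z j" for j
      using item[of j] q(1) V' by (auto simp: z_def)
    moreover have "z k + U $ j $ k \<le> z j" for j k
      using item[of j] q(2)[of _ k] V' by (auto simp: z_def assms(4))
    ultimately have "?m t j \<le> z j" for t j
      by (rule max_plus_iterate_le_supersolution)
    then have "y $ j \<le> z j"
      using LIMSEQ_le_const2[OF lim[of j]] by blast
    then show ?thesis by (simp add: z_def assms(6))
  qed
  have "revenue q \<tau> \<le> revenue p \<sigma>'"
    if "envy_free_allocation V p \<sigma>'" "envy_free_allocation V q \<tau>" for \<sigma>' q \<tau>
    using that dominates[OF that(2)]
    by (auto simp: envy_free_allocation_def revenue_bij intro: sum_mono)
  with conv ef show ?thesis unfolding maximizes_revenue_def by blast
qed

end
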